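(* Let $A$ be a subset of a metric space $X$. Then the following conditions are equivalent: (i) $A$ is a closed set which does not contain isolated points of $X$; (ii) there exists a continuous function $f\colon X\to\mathbb{R}$ such that $\mathbb{L}^{\infty}(f)=L^{\infty}(f)=A$.
   Context: Let $X$ be a metric space with metric $|\cdot-\cdot|_X$ and open balls $B(x,r)$. Convention: $\sup\varnothing=0$. For $f\colon X\to\mathbb{R}$ and $x\in X$: the big Lipschitz derivative is $\operatorname{Lip}f(x)=\limsup_{r\to0^+}\frac1r\sup_{u\in B(x,r)}|f(x)-f(u)|$; the local Lipschitz derivative is $\mathbb{L}\mathrm{ip}f(x)=\inf_{r>0}\ \sup_{u,v\in B(x,r),\,u\ne v}\frac{|f(u)-f(v)|}{|u-v|_X}$. Both are $0$ at isolated points of $X$. Put $L^\infty(f)=\{x\in X:\operatorname{Lip}f(x)=\infty\}$ and $\mathbb{L}^\infty(f)=\{x\in X:\mathbb{L}\mathrm{ip}f(x)=\infty\}$. "Isolated points of $X$" means points isolated in the whole space $X$ (not in the subspace $A$). *)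

theory Defs
  imports "HOL-Analysis.Analysis"
begin

text \<open>
  Values are taken in \<^typ>\<open>ennreal\<close>, where the supremum of the empty set is \<open>0\<close>, as the
  convention requires; hence both derivatives vanish at isolated points.
\<close>

definition big_Lip :: "('a::metric_space \<Rightarrow> real) \<Rightarrow> 'a \<Rightarrow> ennreal" where
  "big_Lip f x =
    Limsup (at_right (0::real)) (\<lambda>r. ennreal (1 / r) * (SUP u\<in>ball x r. ennreal \<bar>f x - f u\<bar>))"

definition local_Lip :: "('a::metric_space \<Rightarrow> real) \<Rightarrow> 'a \<Rightarrow> ennreal" where
  "local_Lip f x =
    (INF r\<in>{0::real<..}.
      SUP (u, v)\<in>{(u, v). u \<in> ball x r \<and> v \<in> ball x r \<and> u \<noteq> v}.
        ennreal (\<bar>f u - f v\<bar> / dist u v))"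

definition big_Lip_infty :: "('a::metric_space \<Rightarrow> real) \<Rightarrow> 'a set" where
  "big_Lip_infty f = {x. big_Lip f x = \<infinity>}"

definition local_Lip_infty :: "('a::metric_space \<Rightarrow> real) \<Rightarrow> 'a set" where
  "local_Lip_infty f = {x. local_Lip f x = \<infinity>}"

lemma isolated_ball:
  fixes x :: "'a::metric_space"
  assumes "x isolated_in UNIV"
  obtains e where "e > 0" "\<And>r. 0 < r \<Longrightarrow> r \<le> e \<Longrightarrow> ball x r = {x}"
proof -
  obtain e where e: "e > 0" "\<And>y. dist x y < e \<Longrightarrow> y = x"
    using assms unfolding isolated_in_dist_Ex_iff by blast
  have "ball x r = {x}" if "0 < r" "r \<le> e" for r
    using e(2) that by force
  with e(1) show thesis using that by blast
qed

lemma big_Lip_isolated: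
  assumes "x isolated_in UNIV"
  shows "big_Lip f x = 0"
proof -
  obtain e where e: "e > 0" "\<And>r. 0 < r \<Longrightarrow> r \<le> e \<Longrightarrow> ball x r = {x}"
    using isolated_ball[OF assms] by blast
  have "eventually (\<lambda>r. ennreal (1 / r) * (SUP u\<in>ball x r. ennreal \<bar>f x - f u\<bar>) = 0) (at_right (0::real))"
    unfolding eventually_at_right_field using e by (intro exI[of _ e]) auto
  then have "big_Lip f x = Limsup (at_right (0::real)) (\<lambda>r. 0)"
    unfolding big_Lip_def by (rule Limsup_eq)
  then show ?thesis by (simp add: Limsup_const)
qed

lemma local_Lip_isolated:
  assumes "x isolated_in UNIV"
  shows "local_Lip f x = 0"
proof -
  obtain e where e: "e > 0" "ball x e = {x}"
    using isolated_ball[OF assms] by (metis order_refl)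
  then have "{(u, v). u \<in> ball x e \<and> v \<in> ball x e \<and> u \<noteq> v} = {}" by auto
  then have "(SUP (u, v)\<in>{(u, v). u \<in> ball x e \<and> v \<in> ball x e \<and> u \<noteq> v}.
        ennreal (\<bar>f u - f v\<bar> / dist u v)) = 0"
    by (simp only: SUP_empty bot_ennreal)
  moreover have "local_Lip f x \<le> (SUP (u, v)\<in>{(u, v). u \<in> ball x e \<and> v \<in> ball x e \<and> u \<noteq> v}.
        ennreal (\<bar>f u - f v\<bar> / dist u v))"
    unfolding local_Lip_def by (rule INF_lower) (use e in simp)
  ultimately show ?thesis by simp
qed

end

theory Submission
  imports Defs
begin

text \<open>
  That (ii) implies (i) is soft: a Lipschitz bound on a ball bounds the local Lipschitz derivative
  at every point of that ball, so the set where this derivative is infinite is closed; and the big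
  Lipschitz derivative vanishes at isolated points.

  For the converse, the difficulty is that \<open>A\<close> may contain points near which \<open>X\<close> is very sparse, at
  scales that depend on the point, so a sum of oscillations at prescribed scales need not be steep
  there. Instead the function is built from distances to nets. Choose an increasing
  sequence \<open>S\<^sub>0 \<subseteq> S\<^sub>1 \<subseteq> \<dots>\<close> of subsets of \<open>A\<close>, where \<open>S\<^sub>n\<close> is a maximal \<open>8\<^sup>-\<^sup>n\<close>-separated subset of \<open>A\<close>,
  and put
  \[ f(x) = \sum_n 4^n \min(d(x, S_n), 8^{-n}). \]
  The weights outgrow their partial sums by a factor above 2, and the truncation is fine enough to
  bound the terms by \<open>2\<^sup>-\<^sup>n\<close>, so that \<open>f\<close> is continuous. Near a point at distance more than \<open>8\<^sup>-\<^sup>n\<close>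
  from \<open>A\<close>, the terms from the \<open>n\<close>-th on are constant, so \<open>f\<close> is locally Lipschitz off \<open>A\<close>.

  The steepness on \<open>A\<close> comes from the monotonicity of the nets. If \<open>p \<in> S\<^sub>n\<close>, then all terms from
  the \<open>n\<close>-th on vanish at \<open>p\<close>, hence can only increase when moving from \<open>p\<close> to another point \<open>q\<close>,
  while the earlier terms together have Lipschitz constant below \<open>4\<^sup>n/3\<close>. So \<open>f q - f p\<close> is at
  least \<open>4\<^sup>n/6\<close> times \<open>d(p,q)\<close> as soon as the \<open>n\<close>-th distance at \<open>q\<close> is at least half of \<open>d(p,q)\<close>
  (\<open>net_sum_increase\<close>). A point \<open>x\<close> of some \<open>S\<^sub>m\<close> can serve as \<open>p\<close> for every \<open>n \<ge> m\<close>, with \<open>q\<close> any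
  point of \<open>X\<close> near \<open>x\<close>; such a \<open>q\<close> exists because \<open>x\<close> is not isolated. Any other point \<open>x\<close> of \<open>A\<close>
  serves as \<open>q\<close> for every \<open>n\<close>, with \<open>p\<close> an almost nearest point of \<open>S\<^sub>n\<close>, which is close to \<open>x\<close> by
  maximality (\<open>net_sum_steep\<close>).
\<close>

section \<open>Criteria for finite and infinite Lipschitz derivatives\<close>

lemma big_Lip_eq_top_if_steep:
  fixes f :: "'a::metric_space \<Rightarrow> real"
  assumes steep: "\<And>M e. 0 < M \<Longrightarrow> 0 < e \<Longrightarrow> \<exists>u. u \<noteq> x \<and> dist x u < e \<and> M * dist x u \<le> \<bar>f x - f u\<bar>"
  shows "big_Lip f x = \<infinity>"
proof -
  have *: "ennreal C \<le> big_Lip f x" if "0 < C" for C :: real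
    unfolding big_Lip_def Limsup_def
  proof (rule INF_greatest)
    fix P :: "real \<Rightarrow> bool" assume "P \<in> {P. eventually P (at_right 0)}"
    then obtain b where b: "0 < b" "\<And>r. 0 < r \<Longrightarrow> r < b \<Longrightarrow> P r"
      by (auto simp: eventually_at_right_field)
    obtain u where u: "u \<noteq> x" "dist x u < b / 2" "2 * C * dist x u \<le> \<bar>f x - f u\<bar>"
      using steep[of "2 * C" "b / 2"] \<open>0 < C\<close> b(1) by auto
    \<comment> \<open>The balls are open, so the radius has to exceed the distance; doubling it costs a factor 2.\<close>
    define r where "r = 2 * dist x u"
    have r: "0 < r" "r < b" "u \<in> ball x r" using u by (auto simp: r_def)
    have "C \<le> (1 / r) * \<bar>f x - f u\<bar>"
      using u r by (simp add: r_def field_simps)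
    then have "ennreal C \<le> ennreal (1 / r) * ennreal \<bar>f x - f u\<bar>"
      using r(1) by (simp add: ennreal_mult[symmetric] ennreal_leI)
    also have "\<dots> \<le> ennreal (1 / r) * (SUP u\<in>ball x r. ennreal \<bar>f x - f u\<bar>)"
      using r(3) by (intro mult_left_mono SUP_upper) auto
    also have "\<dots> \<le> (SUP r\<in>Collect P. ennreal (1 / r) * (SUP u\<in>ball x r. ennreal \<bar>f x - f u\<bar>))"
      using b(2) r by (intro SUP_upper) auto
    finally show "ennreal C \<le> (SUP r\<in>Collect P. ennreal (1 / r) * (SUP u\<in>ball x r. ennreal \<bar>f x - f u\<bar>))" .
  qed
  show ?thesis
  proof (rule ccontr)
    assume "big_Lip f x \<noteq> \<infinity>"
    then obtain c where c: "0 \<le> c" "big_Lip f x = ennreal c"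
      by (cases "big_Lip f x") auto
    with *[of "c + 1"] show False by simp
  qed
qed

lemma local_Lip_eq_top_if_steep:
  fixes f :: "'a::metric_space \<Rightarrow> real"
  assumes steep: "\<And>M e. 0 < M \<Longrightarrow> 0 < e \<Longrightarrow> \<exists>u. u \<noteq> x \<and> dist x u < e \<and> M * dist x u \<le> \<bar>f x - f u\<bar>"
  shows "local_Lip f x = \<infinity>"
proof -
  have *: "ennreal C \<le> local_Lip f x" if "0 < C" for C :: real
    unfolding local_Lip_def
  proof (rule INF_greatest)
    fix r :: real assume "r \<in> {0<..}"
    then obtain u where u: "u \<noteq> x" "dist x u < r" "C * dist x u \<le> \<bar>f x - f u\<bar>"
      using steep[of C r] \<open>0 < C\<close> by auto
    show "ennreal C \<le> (SUP (u, v)\<in>{(u, v). u \<in> ball x r \<and> v \<in> ball x r \<and> u \<noteq> v}.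
        ennreal (\<bar>f u - f v\<bar> / dist u v))"
      using u \<open>r \<in> {0<..}\<close> by (intro SUP_upper2[of "(x, u)"]) (auto intro!: ennreal_leI simp: field_simps)
  qed
  show ?thesis
  proof (rule ccontr)
    assume "local_Lip f x \<noteq> \<infinity>"
    then obtain c where c: "0 \<le> c" "local_Lip f x = ennreal c"
      by (cases "local_Lip f x") auto
    with *[of "c + 1"] show False by simp
  qed
qed

lemma big_Lip_finite_if_locally_lipschitz:
  fixes f :: "'a::metric_space \<Rightarrow> real"
  assumes e: "0 < e" and L: "0 \<le> L"
    and lip: "\<And>u v. u \<in> ball x e \<Longrightarrow> v \<in> ball x e \<Longrightarrow> \<bar>f u - f v\<bar> \<le> L * dist u v"
  shows "big_Lip f x < \<infinity>"
proof -
  have "big_Lip f x \<le> ennreal L"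
    unfolding big_Lip_def
  proof (rule Limsup_bounded)
    have "ennreal (1 / r) * (SUP u\<in>ball x r. ennreal \<bar>f x - f u\<bar>) \<le> ennreal L"
      if r: "0 < r" "r < e" for r
    proof -
      have "(SUP u\<in>ball x r. ennreal \<bar>f x - f u\<bar>) \<le> ennreal (L * r)"
      proof (intro SUP_least ennreal_leI)
        fix u assume "u \<in> ball x r"
        then have "\<bar>f x - f u\<bar> \<le> L * dist x u" "dist x u \<le> r" using lip[of x u] r by auto
        then show "\<bar>f x - f u\<bar> \<le> L * r" using L by (meson mult_left_mono order_trans)
      qed
      then have "ennreal (1 / r) * (SUP u\<in>ball x r. ennreal \<bar>f x - f u\<bar>)
          \<le> ennreal (1 / r) * ennreal (L * r)" by (intro mult_left_mono) auto
      also have "\<dots> = ennreal L" using r L by (simp add: ennreal_mult[symmetric])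
      finally show ?thesis .
    qed
    then show "eventually (\<lambda>r. ennreal (1 / r) * (SUP u\<in>ball x r. ennreal \<bar>f x - f u\<bar>) \<le> ennreal L)
        (at_right 0)"
      unfolding eventually_at_right_field using e by blast
  qed
  then show ?thesis by (simp add: le_less_trans)
qed

lemma local_Lip_finite_if_locally_lipschitz:
  fixes f :: "'a::metric_space \<Rightarrow> real"
  assumes e: "0 < e"
    and lip: "\<And>u v. u \<in> ball x e \<Longrightarrow> v \<in> ball x e \<Longrightarrow> \<bar>f u - f v\<bar> \<le> L * dist u v"
  shows "local_Lip f x < \<infinity>"
proof -
  have "local_Lip f x \<le> (SUP (u, v)\<in>{(u, v). u \<in> ball x e \<and> v \<in> ball x e \<and> u \<noteq> v}.
        ennreal (\<bar>f u - f v\<bar> / dist u v))"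
    unfolding local_Lip_def by (rule INF_lower) (use e in simp)
  also have "\<dots> \<le> ennreal L"
    using lip by (intro SUP_least) (auto intro!: ennreal_leI simp: divide_le_eq)
  finally show ?thesis by (simp add: le_less_trans)
qed

text \<open>
  A bound for the difference quotients on a ball around \<open>x\<close> is also a bound on the smaller balls
  inside it that are centred at nearby points.
\<close>

lemma closed_local_Lip_infty: "closed (local_Lip_infty f)"
proof -
  have "open (- local_Lip_infty f)"
    unfolding open_contains_ball
  proof
    fix x assume "x \<in> - local_Lip_infty f"
    then have "local_Lip f x < \<infinity>" by (simp add: local_Lip_infty_def less_top)
    then obtain r where r: "0 < r" and fin: "(SUP (u, v)\<in>{(u, v). u \<in> ball x r \<and> v \<in> ball x r \<and> u \<noteq> v}.
        ennreal (\<bar>f u - f v\<bar> / dist u v)) < \<infinity>" (is "?S < _")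
      unfolding local_Lip_def INF_less_iff by auto
    have "local_Lip f y < \<infinity>" if y: "y \<in> ball x r" for y
    proof -
      define s where "s = r - dist x y"
      have s: "0 < s" "ball y s \<subseteq> ball x r"
        using y dist_triangle[of x _ y] by (auto simp: s_def) (smt (verit))
      have "local_Lip f y \<le> (SUP (u, v)\<in>{(u, v). u \<in> ball y s \<and> v \<in> ball y s \<and> u \<noteq> v}.
          ennreal (\<bar>f u - f v\<bar> / dist u v))"
        unfolding local_Lip_def by (rule INF_lower) (use s in simp)
      also have "\<dots> \<le> ?S" using s(2) by (intro SUP_subset_mono) auto
      finally show ?thesis using fin by (rule le_less_trans)
    qed
    then have "ball x r \<subseteq> - local_Lip_infty f"
      unfolding local_Lip_infty_def by fastforce
    then show "\<exists>e>0. ball x e \<subseteq> - local_Lip_infty f" using r by blast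
  qed
  then show ?thesis by (simp add: closed_open)
qed

section \<open>Increasing sequences of nets\<close>

definition separated :: "real \<Rightarrow> 'a::metric_space set \<Rightarrow> bool" where
  "separated r S \<longleftrightarrow> (\<forall>x\<in>S. \<forall>y\<in>S. x \<noteq> y \<longrightarrow> r \<le> dist x y)"

lemma separated_extends_to_net:
  fixes A :: "'a::metric_space set"
  assumes "0 < r" "T \<subseteq> A" "separated r T"
  shows "\<exists>S. T \<subseteq> S \<and> S \<subseteq> A \<and> separated r S \<and> (\<forall>x\<in>A. \<exists>s\<in>S. dist x s < r)"
proof -
  define F where "F = {S. T \<subseteq> S \<and> S \<subseteq> A \<and> separated r S}"
  have "\<exists>M\<in>F. \<forall>X\<in>F. M \<subseteq> X \<longrightarrow> X = M"
  proof (rule subset_Zorn_nonempty)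
    show "F \<noteq> {}" using assms by (auto simp: F_def)
  next
    fix C assume C: "C \<noteq> {}" "subset.chain F C"
    then have sub: "C \<subseteq> F" by (simp add: subset_chain_def)
    have "separated r (\<Union>C)"
      unfolding separated_def
    proof (intro ballI impI)
      fix x y assume "x \<in> \<Union>C" "y \<in> \<Union>C" "x \<noteq> y"
      then obtain X Y where XY: "X \<in> C" "Y \<in> C" "x \<in> X" "y \<in> Y" by auto
      then have "X \<subseteq> Y \<or> Y \<subseteq> X" using C(2) by (auto simp: subset_chain_def)
      then obtain Z where "Z \<in> C" "x \<in> Z" "y \<in> Z" using XY by blast
      then show "r \<le> dist x y" using sub \<open>x \<noteq> y\<close> by (auto simp: F_def separated_def)
    qed
    then show "\<Union>C \<in> F" using C(1) sub by (auto simp: F_def)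
  qed
  then obtain S where S: "S \<in> F" and max: "\<And>X. X \<in> F \<Longrightarrow> S \<subseteq> X \<Longrightarrow> X = S" by blast
  have "\<exists>s\<in>S. dist x s < r" if "x \<in> A" for x
  proof (rule ccontr)
    assume "\<not> (\<exists>s\<in>S. dist x s < r)"
    then have far: "\<forall>s\<in>S. r \<le> dist x s" by (auto simp: not_less)
    then have "insert x S \<in> F"
      using S \<open>x \<in> A\<close> by (auto simp: F_def separated_def dist_commute)
    then have "x \<in> S" using max[of "insert x S"] by auto
    with far \<open>0 < r\<close> show False by force
  qed
  with S show ?thesis by (auto simp: F_def)
qed

lemma increasing_nets_exist:
  fixes A :: "'a::metric_space set"
  obtains S :: "nat \<Rightarrow> 'a set"
  where "\<And>n. S n \<subseteq> A" "\<And>n. separated (1 / 8 ^ n) (S n)"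
    "\<And>n x. x \<in> A \<Longrightarrow> \<exists>s\<in>S n. dist x s < 1 / 8 ^ n" "\<And>m n. m \<le> n \<Longrightarrow> S m \<subseteq> S n"
proof -
  define P where "P n S \<longleftrightarrow> S \<subseteq> A \<and> separated (1 / 8 ^ n) S \<and> (\<forall>x\<in>A. \<exists>s\<in>S. dist x s < 1 / 8 ^ n)"
    for n :: nat and S
  have "\<exists>S. \<forall>n. P n (S n) \<and> S n \<subseteq> S (Suc n)"
  proof (rule dependent_nat_choice)
    show "\<exists>S. P 0 S"
      using separated_extends_to_net[of "1 / 8 ^ 0" "{}" A] by (auto simp: P_def separated_def)
  next
    fix T and n :: nat assume "P n T"
    moreover have "(1::real) / 8 ^ Suc n \<le> 1 / 8 ^ n" by (simp add: field_simps)
    ultimately have "separated (1 / 8 ^ Suc n) T" "T \<subseteq> A"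
      unfolding P_def separated_def by (meson order_trans)+
    moreover have "(0::real) < 1 / 8 ^ Suc n" by simp
    ultimately show "\<exists>S. P (Suc n) S \<and> T \<subseteq> S"
      using separated_extends_to_net[of "1 / 8 ^ Suc n" T A] unfolding P_def by blast
  qed
  then obtain S where S: "\<And>n. P n (S n)" "\<And>n. S n \<subseteq> S (Suc n)" by blast
  show thesis
  proof
    show "S m \<subseteq> S n" if "m \<le> n" for m n using S(2) that by (rule lift_Suc_mono_le)
  qed (use S(1) in \<open>simp_all add: P_def\<close>)
qed

lemma le_infdist_if_le_dist:
  assumes "S \<noteq> {}" "\<And>s. s \<in> S \<Longrightarrow> c \<le> dist x s"
  shows "c \<le> infdist x S"
  using cINF_greatest[of S c "dist x"] assms by (simp add: infdist_def)

lemma infdist_near_separated: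
  assumes "separated r S" "x \<in> S" "dist x u \<le> r / 2"
  shows "infdist u S = dist x u"
proof (rule antisym)
  show "infdist u S \<le> dist x u" using infdist_le[OF assms(2), of u] by (simp add: dist_commute)
  have "dist x u \<le> dist u s" if "s \<in> S" for s
  proof (cases "s = x")
    case False
    then have "r \<le> dist x s" using assms that by (auto simp: separated_def)
    then show ?thesis using assms(3) dist_triangle[of x s u] by linarith
  qed (simp add: dist_commute)
  then show "dist x u \<le> infdist u S"
    using assms(2) by (intro le_infdist_if_le_dist) auto
qed

lemma separated_closed:
  assumes "separated r S" "0 < r"
  shows "closed S"
  using assms by (intro discrete_imp_closed[of r]) (auto simp: separated_def dist_commute, force simp: dist_commute)

section \<open>The sum of truncated distances to the nets\<close>

definition net_dist :: "(nat \<Rightarrow> 'a::metric_space set) \<Rightarrow> nat \<Rightarrow> 'a \<Rightarrow> real" where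
  "net_dist S n x = min (infdist x (S n)) (1 / 8 ^ n)"

definition net_sum :: "(nat \<Rightarrow> 'a::metric_space set) \<Rightarrow> 'a \<Rightarrow> real" where
  "net_sum S x = (\<Sum>n. 4 ^ n * net_dist S n x)"

lemma net_dist_nonneg: "0 \<le> net_dist S n x"
  by (simp add: net_dist_def infdist_nonneg)

lemma net_dist_lipschitz: "\<bar>net_dist S n u - net_dist S n v\<bar> \<le> dist u v"
  using infdist_triangle[of u "S n" v] infdist_triangle[of v "S n" u]
  by (auto simp: net_dist_def dist_commute min_def)

lemma net_sum_term_le: "4 ^ n * net_dist S n x \<le> (1 / 2) ^ n"
proof -
  have "4 ^ n * net_dist S n x \<le> 4 ^ n * (1 / 8 ^ n)"
    by (intro mult_left_mono) (auto simp: net_dist_def)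
  also have "\<dots> = (1 / 2 :: real) ^ n" by (simp add: power_divide[symmetric])
  finally show ?thesis .
qed

lemma norm_net_sum_term_le: "norm (4 ^ n * net_dist S n x) \<le> (1 / 2) ^ n"
  using net_sum_term_le[of n S x] net_dist_nonneg[of S n x] by simp

lemma summable_net_sum: "summable (\<lambda>n. 4 ^ n * net_dist S n x)"
  by (rule summable_comparison_test'[of "\<lambda>n. (1 / 2) ^ n"])
    (use norm_net_sum_term_le in \<open>auto intro: summable_geometric\<close>)

lemma net_sum_diff: "net_sum S u - net_sum S v = (\<Sum>n. 4 ^ n * (net_dist S n u - net_dist S n v))"
  using suminf_diff[OF summable_net_sum summable_net_sum, of S u S v]
  by (simp add: net_sum_def right_diff_distrib)

lemma continuous_net_sum: "continuous_on UNIV (net_sum S)"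
proof -
  have "continuous_on UNIV (\<lambda>x. \<Sum>k<n. 4 ^ k * net_dist S k x)" for n
    unfolding net_dist_def by (intro continuous_intros)
  moreover have "uniform_limit UNIV (\<lambda>n x. \<Sum>k<n. 4 ^ k * net_dist S k x) (net_sum S) sequentially"
    unfolding net_sum_def
    by (rule Weierstrass_m_test[of _ _ "\<lambda>n. (1 / 2) ^ n"])
      (use norm_net_sum_term_le in \<open>auto intro: summable_geometric\<close>)
  ultimately show ?thesis
    by (intro uniform_limit_theorem[where f = "\<lambda>n x. \<Sum>k<n. 4 ^ k * net_dist S k x" and F = sequentially]) auto
qed

text \<open>
  The truncation at \<open>8\<^sup>-\<^sup>n\<close> makes all but finitely many terms constant on a ball that stays
  away from the nets.
\<close>

lemma net_sum_locally_lipschitz: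
  assumes sub: "\<And>n. S n \<subseteq> A" and e: "0 < e" and disj: "ball x e \<inter> A = {}"
  shows "\<exists>L\<ge>0. \<forall>u\<in>ball x (e / 2). \<forall>v\<in>ball x (e / 2).
    \<bar>net_sum S u - net_sum S v\<bar> \<le> L * dist u v"
proof -
  obtain N where N: "(1 / 8 :: real) ^ N < e / 2"
    using real_arch_pow_inv[of "e / 2" "1 / 8"] e by auto
  have eq: "net_dist S n u = net_dist S n v" if "N \<le> n" "u \<in> ball x (e / 2)" "v \<in> ball x (e / 2)" for n u v
  proof (cases "S n = {}")
    case True
    \<comment> \<open>The distance to the empty set is \<open>0\<close> by convention, so the term is constant here too.\<close>
    then show ?thesis by (simp add: net_dist_def infdist_def)
  next
    case False
    have "net_dist S n w = 1 / 8 ^ n" if w: "w \<in> ball x (e / 2)" for w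
    proof -
      have "(1 / 8 :: real) ^ n \<le> (1 / 8) ^ N" using \<open>N \<le> n\<close> by (intro power_decreasing) auto
      then have n: "1 / 8 ^ n < e / 2" using N by (simp add: power_divide)
      have "e / 2 \<le> dist w s" if "s \<in> S n" for s
      proof -
        have "e \<le> dist x s" using disj sub[of n] that by (fastforce simp: not_less[symmetric])
        then show ?thesis using w dist_triangle[of x s w] by simp
      qed
      then have "e / 2 \<le> infdist w (S n)"
        using False by (intro le_infdist_if_le_dist)
      then show ?thesis using n by (simp add: net_dist_def)
    qed
    then show ?thesis using that by simp
  qed
  define L :: real where "L = (\<Sum>n<N. 4 ^ n)"
  show ?thesis
  proof (intro exI[of _ L] conjI ballI)
    show "0 \<le> L" by (simp add: L_def sum_nonneg)
    fix u v assume uv: "u \<in> ball x (e / 2)" "v \<in> ball x (e / 2)"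
    have "net_sum S u - net_sum S v = (\<Sum>n<N. 4 ^ n * (net_dist S n u - net_dist S n v))"
      unfolding net_sum_diff using eq[OF _ uv] by (intro suminf_finite) (auto simp: not_less)
    also have "\<bar>\<dots>\<bar> \<le> (\<Sum>n<N. \<bar>4 ^ n * (net_dist S n u - net_dist S n v)\<bar>)" by (rule sum_abs)
    also have "\<dots> \<le> (\<Sum>n<N. 4 ^ n * dist u v)"
      by (intro sum_mono) (simp add: abs_mult net_dist_lipschitz)
    finally show "\<bar>net_sum S u - net_sum S v\<bar> \<le> L * dist u v" by (simp add: L_def sum_distrib_right)
  qed
qed

text \<open>
  At a point \<open>p\<close> of the \<open>n\<close>-th net all terms from the \<open>n\<close>-th on have their minimum \<open>0\<close>, and only
  the earlier ones, whose weights sum to less than \<open>4\<^sup>n/3\<close>, can decrease away from \<open>p\<close>.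
\<close>

lemma net_sum_increase:
  assumes mono: "\<And>m n. m \<le> n \<Longrightarrow> S m \<subseteq> S n" and p: "p \<in> S n"
    and half: "dist p q / 2 \<le> net_dist S n q"
  shows "4 ^ n / 6 * dist p q \<le> net_sum S q - net_sum S p"
proof -
  let ?t = "\<lambda>k. 4 ^ k * (net_dist S k q - net_dist S k p)"
  have zero: "net_dist S k p = 0" if "n \<le> k" for k
    using mono[OF that] p by (auto simp: net_dist_def infdist_zero)
  have "(\<Sum>k<n. 4 ^ k :: real) \<le> 4 ^ n / 3"
    by (simp add: geometric_sum)
  then have "(\<Sum>k<n. 4 ^ k) * dist p q \<le> 4 ^ n / 3 * dist p q"
    by (rule mult_right_mono) simp
  then have "- (4 ^ n / 3 * dist p q) \<le> - ((\<Sum>k<n. 4 ^ k) * dist p q)" by simp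
  also have "\<dots> = (\<Sum>k<n. 4 ^ k * - dist p q)" by (simp add: sum_distrib_right sum_negf)
  also have "\<dots> \<le> (\<Sum>k<n. ?t k)"
  proof (intro sum_mono mult_left_mono)
    show "- dist p q \<le> net_dist S k q - net_dist S k p" for k
      using net_dist_lipschitz[of S k p q] by linarith
  qed simp
  finally have early: "- (4 ^ n / 3 * dist p q) \<le> (\<Sum>k<n. ?t k)" .
  have "4 ^ n / 2 * dist p q \<le> ?t n"
    using mult_left_mono[OF half, of "4 ^ n"] zero[of n] by simp
  with early have "4 ^ n / 6 * dist p q \<le> (\<Sum>k<Suc n. ?t k)"
    unfolding sum.lessThan_Suc by linarith
  also have "\<dots> \<le> (\<Sum>k. ?t k)"
  proof (rule sum_le_suminf)
    show "summable ?t"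
      using summable_diff[OF summable_net_sum summable_net_sum, of S q S p]
      by (simp add: right_diff_distrib)
    show "0 \<le> ?t k" if "k \<in> - {..<Suc n}" for k
      using that zero[of k] net_dist_nonneg[of S k q] by simp
  qed simp
  also have "\<dots> = net_sum S q - net_sum S p" by (simp add: net_sum_diff)
  finally show ?thesis .
qed

text \<open>
  A point of the union of the nets is compared with any close point of the space, a point outside
  the union with an almost nearest point of a fine net.
\<close>

lemma net_sum_steep:
  fixes x :: "'a::metric_space"
  assumes mono: "\<And>m n. m \<le> n \<Longrightarrow> S m \<subseteq> S n"
    and sep: "\<And>n. separated (1 / 8 ^ n) (S n)"
    and net: "\<And>n. \<exists>s\<in>S n. dist x s < 1 / 8 ^ n"
    and nisol: "\<not> x isolated_in UNIV" and "0 < e"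
  shows "\<exists>u. u \<noteq> x \<and> dist x u < e \<and> M * dist x u \<le> \<bar>net_sum S x - net_sum S u\<bar>"
proof -
  obtain N1 where N1: "6 * M < 4 ^ N1" using real_arch_pow[of 4 "6 * M"] by auto
  obtain N2 where N2: "(1 / 8 :: real) ^ N2 < e" using real_arch_pow_inv[of e "1 / 8"] \<open>0 < e\<close> by auto
  have M: "M * d \<le> 4 ^ n / 6 * d" if "N1 \<le> n" "0 \<le> d" for n d
  proof (rule mult_right_mono)
    have "(4::real) ^ N1 \<le> 4 ^ n" using that by (intro power_increasing) auto
    then show "M \<le> 4 ^ n / 6" using N1 by linarith
  qed (use that in simp)
  have e: "1 / 8 ^ n < e" if "N2 \<le> n" for n
  proof -
    have "(1 / 8 :: real) ^ n \<le> (1 / 8) ^ N2" using that by (intro power_decreasing) auto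
    then show ?thesis using N2 by (simp add: power_divide)
  qed
  show ?thesis
  proof (cases "\<exists>m. x \<in> S m")
    case True
    then obtain m where m: "x \<in> S m" by blast
    define n where "n = max m (max N1 N2)"
    have n: "N1 \<le> n" "N2 \<le> n" by (auto simp: n_def)
    have xn: "x \<in> S n" using m mono[of m n] by (auto simp: n_def)
    define r :: real where "r = 1 / 8 ^ n"
    have "0 < r" by (simp add: r_def)
    then obtain u where u: "u \<noteq> x" "dist x u < r / 2"
      using nisol unfolding isolated_in_dist_Ex_iff
      by (metis UNIV_I half_gt_zero)
    have "infdist u (S n) = dist x u"
      using infdist_near_separated[OF sep xn] u by (simp add: r_def)
    moreover have "dist x u / 2 \<le> dist x u" "dist x u / 2 \<le> r"
      using u(2) zero_le_dist[of x u] by linarith+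
    ultimately have half: "dist x u / 2 \<le> net_dist S n u" unfolding net_dist_def r_def by simp
    have "4 ^ n / 6 * dist x u \<le> net_sum S u - net_sum S x"
      by (rule net_sum_increase) (fact mono xn half)+
    then have "M * dist x u \<le> \<bar>net_sum S x - net_sum S u\<bar>"
      using M[OF n(1), of "dist x u"] zero_le_dist[of x u] by linarith
    moreover have "dist x u < e"
      using u(2) e[OF n(2), folded r_def] \<open>0 < r\<close> by linarith
    ultimately show ?thesis using u(1) by blast
  next
    case False
    \<comment> \<open>One more index than above, as the chosen point may be twice as far as the nearest one.\<close>
    define n where "n = Suc (max N1 N2)"
    have n: "N1 \<le> n" "N2 \<le> n - 1" by (auto simp: n_def)
    obtain s where s: "s \<in> S n" "dist x s < 1 / 8 ^ n" using net by blast
    have "infdist x (S n) \<noteq> 0"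
      using False s separated_closed[OF sep] in_closed_iff_infdist_zero[of "S n" x] by auto
    then have pos: "0 < infdist x (S n)" using infdist_nonneg[of x "S n"] by linarith
    have small: "infdist x (S n) < 1 / 8 ^ n" using infdist_le[OF s(1), of x] s(2) by linarith
    have "\<exists>p\<in>S n. dist x p < 2 * infdist x (S n)"
    proof (rule ccontr)
      assume "\<not> (\<exists>p\<in>S n. dist x p < 2 * infdist x (S n))"
      then have "2 * infdist x (S n) \<le> infdist x (S n)"
        using s(1) by (intro le_infdist_if_le_dist) (auto simp: not_less)
      with pos show False by simp
    qed
    then obtain p where p: "p \<in> S n" "dist x p < 2 * infdist x (S n)" by blast
    have half: "dist p x / 2 \<le> net_dist S n x"
      using p(2) small by (simp add: net_dist_def dist_commute)
    have "4 ^ n / 6 * dist p x \<le> net_sum S x - net_sum S p"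
      by (rule net_sum_increase) (fact mono p(1) half)+
    then have "M * dist x p \<le> \<bar>net_sum S x - net_sum S p\<bar>"
      using M[OF n(1), of "dist x p"] zero_le_dist[of x p] unfolding dist_commute[of p x] by linarith
    moreover have "dist x p < e"
    proof -
      have "dist x p < 2 * (1 / 8 ^ n)" using p(2) small by linarith
      also have "\<dots> \<le> 1 / 8 ^ (n - 1)" by (simp add: n_def field_simps)
      finally show ?thesis using e[OF n(2)] by linarith
    qed
    moreover have "p \<noteq> x" using False p(1) by auto
    ultimately show ?thesis by blast
  qed
qed

theorem theorem4p2:
  fixes A :: "'a::metric_space set"
  shows "(closed A \<and> (\<forall>x\<in>A. \<not> x isolated_in (UNIV :: 'a set)))
    \<longleftrightarrow> (\<exists>f :: 'a \<Rightarrow> real. continuous_on UNIV f \<and> local_Lip_infty f = big_Lip_infty f \<and> big_Lip_infty f = A)"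
proof
  assume A: "closed A \<and> (\<forall>x\<in>A. \<not> x isolated_in (UNIV :: 'a set))"
  obtain S where S: "\<And>n. S n \<subseteq> A" "\<And>n. separated (1 / 8 ^ n) (S n)"
    "\<And>n x. x \<in> A \<Longrightarrow> \<exists>s\<in>S n. dist x s < 1 / 8 ^ n" "\<And>m n. m \<le> n \<Longrightarrow> S m \<subseteq> S n"
    using increasing_nets_exist[of A] by blast
  have on: "big_Lip (net_sum S) x = \<infinity> \<and> local_Lip (net_sum S) x = \<infinity>" if "x \<in> A" for x
  proof -
    have "\<exists>u. u \<noteq> x \<and> dist x u < e \<and> M * dist x u \<le> \<bar>net_sum S x - net_sum S u\<bar>" if "0 < e" for M e
      using S(2,3,4) A \<open>x \<in> A\<close> that by (intro net_sum_steep) auto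
    then show ?thesis
      using big_Lip_eq_top_if_steep[of x "net_sum S"] local_Lip_eq_top_if_steep[of x "net_sum S"] by blast
  qed
  have off: "big_Lip (net_sum S) x < \<infinity> \<and> local_Lip (net_sum S) x < \<infinity>" if "x \<notin> A" for x
  proof -
    have "open (- A)" "x \<in> - A" using A that by auto
    then obtain e where e: "0 < e" "ball x e \<subseteq> - A"
      using open_contains_ball by blast
    then have disj: "ball x e \<inter> A = {}" by blast
    obtain L where L: "0 \<le> L"
      "\<And>u v. u \<in> ball x (e / 2) \<Longrightarrow> v \<in> ball x (e / 2) \<Longrightarrow> \<bar>net_sum S u - net_sum S v\<bar> \<le> L * dist u v"
      using net_sum_locally_lipschitz[of S, OF S(1) e(1) disj] by metis
    have "0 < e / 2" using e(1) by simp
    from big_Lip_finite_if_locally_lipschitz[OF this L] local_Lip_finite_if_locally_lipschitz[OF this L(2)]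
    show ?thesis by simp
  qed
  have "big_Lip_infty (net_sum S) = A" "local_Lip_infty (net_sum S) = A"
    using on off by (force simp: big_Lip_infty_def local_Lip_infty_def)+
  then show "\<exists>f :: 'a \<Rightarrow> real. continuous_on UNIV f \<and> local_Lip_infty f = big_Lip_infty f \<and> big_Lip_infty f = A"
    using continuous_net_sum[of S] by (intro exI[of _ "net_sum S"]) simp
next
  assume "\<exists>f :: 'a \<Rightarrow> real. continuous_on UNIV f \<and> local_Lip_infty f = big_Lip_infty f \<and> big_Lip_infty f = A"
  then obtain f :: "'a \<Rightarrow> real" where f: "local_Lip_infty f = A" "big_Lip_infty f = A" by blast
  have "closed A" using closed_local_Lip_infty[of f] f by simp
  moreover have "\<not> x isolated_in UNIV" if "x \<in> A" for x
    using that f(2) big_Lip_isolated[of x f] by (auto simp: big_Lip_infty_def)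
  ultimately show "closed A \<and> (\<forall>x\<in>A. \<not> x isolated_in (UNIV :: 'a set))" by blast
qed

end
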